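(* Let $a>0$ and let $\rho$ be a probability density on $[0,1]$. For all $x\in\mathbb{R}$, when $t\in[0,T]$ is distributed according to the probability measure $\frac1T\rho\left(\frac tT\right)dt$ on $[0,T]$, then, when $T\to\infty$, $$\frac{\mathcal{R}(t\,\mathrm{Rect}(a,a)+(x,x),\mathbb{Z}^2)}{t}$$ converges in distribution. Furthermore, the limit distribution $\beta$ has a compact support included in $[-4,4]$ and for every $k\in\mathbb{N}$, $$\int_{\mathbb{R}}u^k\,d\beta(u)=a_k,\qquad a_k=\frac{4^k(1+(-1)^k)(y^{k+1}+(1-y)^{k+1})}{2(k+1)},$$ where $y=|t_{2,0}-t_{1,0}|$, $t_{2,0}$ is the first $t\geqslant0$ such that $-t+x\in\mathbb{Z}$, and $t_{1,0}$ is the first $t\geqslant0$ such that $t+x\in\mathbb{Z}$.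
   Context: $\mathrm{Rect}(a,a)=[-a,a]\times[-a,a]$. For $P\subset\mathbb{R}^2$ measurable of finite area, $t>0$, $X\in\mathbb{R}^2$: $tP+X$ is $P$ dilated by the factor $t$ about $0$ and then translated by $X$, and $\mathcal{R}(tP+X,\mathbb{Z}^2)=|(tP+X)\cap\mathbb{Z}^2|-t^2\,\mathrm{Area}(P)$.
   Formalization: The printed claim fails for a ≠ 1 (a=2, x=0: the limit is uniform on [-8,8], with second moment 64/3, not a_2=16/3); corrected so that the support lies in [-4a,4a] and the k-th moment is a^k·a_k, which is the printed claim when a=1. *)

theory Defs
  imports "HOL-Probability.Probability"
begin

definition Rect :: "real \<Rightarrow> real \<Rightarrow> (real \<times> real) set" where
  "Rect a b = {-a..a} \<times> {-b..b}"

definition dilate_translate :: "real \<Rightarrow> (real \<times> real) set \<Rightarrow> real \<times> real \<Rightarrow> (real \<times> real) set" where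
  "dilate_translate t P X = (\<lambda>p. t *\<^sub>R p + X) ` P"

text \<open>Only meant for bounded \<^term>\<open>P\<close>, so that the set that is counted is finite.\<close>

definition lattice_remainder :: "real \<Rightarrow> (real \<times> real) set \<Rightarrow> real \<times> real \<Rightarrow> real" where
  "lattice_remainder t P X =
     real (card (dilate_translate t P X \<inter> \<int> \<times> \<int>)) - t\<^sup>2 * measure lebesgue P"

definition scaled_law :: "(real \<Rightarrow> real) \<Rightarrow> real \<Rightarrow> real measure" where
  "scaled_law \<rho> T =
     density lborel (\<lambda>t. ennreal (indicator {0..T} t * ((1 / T) * \<rho> (t / T))))"

definition normalized_remainder_law ::
    "real \<Rightarrow> real \<Rightarrow> (real \<Rightarrow> real) \<Rightarrow> real \<Rightarrow> real measure" where
  "normalized_remainder_law a x \<rho> T =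
     distr (scaled_law \<rho> T) borel (\<lambda>t. lattice_remainder t (Rect a a) (x, x) / t)"

text \<open>
  The library's \<^const>\<open>weak_conv_m\<close> is restricted to sequences; this is the same notion
  along an arbitrary filter.
\<close>

definition weak_conv_along :: "('i \<Rightarrow> real measure) \<Rightarrow> real measure \<Rightarrow> 'i filter \<Rightarrow> bool" where
  "weak_conv_along M \<beta> F \<longleftrightarrow>
     (\<forall>u. isCont (cdf \<beta>) u \<longrightarrow> ((\<lambda>i. cdf (M i) u) \<longlongrightarrow> cdf \<beta> u) F)"

definition measure_support :: "real measure \<Rightarrow> real set" where
  "measure_support \<beta> = {u. \<forall>U. open U \<longrightarrow> u \<in> U \<longrightarrow> 0 < emeasure \<beta> U}"

definition t1_0 :: "real \<Rightarrow> real" where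
  "t1_0 x = (LEAST t. 0 \<le> t \<and> t + x \<in> \<int>)"

definition t2_0 :: "real \<Rightarrow> real" where
  "t2_0 x = (LEAST t. 0 \<le> t \<and> - t + x \<in> \<int>)"

text \<open>
  The limit moments for the square \<^term>\<open>Rect 1 1\<close>. For \<^term>\<open>Rect a a\<close> the limit law is dilated by
  \<^term>\<open>a\<close>, so the \<^term>\<open>k\<close>-th moment acquires a factor \<^term>\<open>a ^ k\<close>.
\<close>

definition moment_coeff :: "real \<Rightarrow> nat \<Rightarrow> real" where
  "moment_coeff x k =
     (let y = \<bar>t2_0 x - t1_0 x\<bar>
      in 4 ^ k * (1 + (-1) ^ k) * (y ^ (k + 1) + (1 - y) ^ (k + 1)) / (2 * (real k + 1)))"

end

theory Submission
  imports Defs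
begin

text \<open>
  Let \<open>D s\<close> be the number of integers in \<open>[x - s, x + s]\<close> minus \<open>2 s\<close>. It is bounded by 1 and
  1-periodic, because raising \<open>s\<close> by 1 adds one integer at each end. The dilated square is a product of
  two equal intervals, so its remainder divided by \<open>t\<close> is \<open>4 a D (a t) + D (a t)\<^sup>2 / t\<close>, where the second
  term is negligible. When \<open>t\<close> is spread over \<open>[0, T]\<close>, Fejer's lemma shows that \<open>a t\<close>
  equidistributes modulo 1, so the limit is the law of \<open>4 a D U\<close> for \<open>U\<close> uniform on \<open>[0, 1)\<close>. With
  \<open>m\<close> the distance from \<open>x\<close> to the nearest integer, \<open>D s\<close> equals \<open>- 2 s\<close>, \<open>1 - 2 s\<close> and \<open>2 - 2 s\<close> on
  \<open>[0, m)\<close>, \<open>[m, 1 - m)\<close> and \<open>[1 - m, 1)\<close>, which gives the moments since \<open>y\<close> is \<open>2 m\<close> or \<open>1 - 2 m\<close>.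
\<close>

section \<open>Averaging a bounded periodic function against an integrable density\<close>

text \<open>A fixed \<open>G\<close> and varying \<open>f\<close> make this a property of
  \<open>f\<close>. For bounded \<open>G\<close> it is preserved by sums and L1 limits of integrable
  functions and by scalar multiples, so it can be carried from intervals to integrable functions on
  the unit interval.\<close>

definition integral_scaled_vanishes :: "(real \<Rightarrow> real) \<Rightarrow> (real \<Rightarrow> real) \<Rightarrow> bool" where
  "integral_scaled_vanishes G f \<longleftrightarrow> ((\<lambda>T. \<integral>s. f s * G (T * s) \<partial>lborel) \<longlongrightarrow> 0) at_top"

lemma integrable_mult_bounded:
  fixes f G :: "real \<Rightarrow> real"
  assumes "integrable lborel f" and "G \<in> borel_measurable borel" and "\<And>s. \<bar>G s\<bar> \<le> C"
  shows "integrable lborel (\<lambda>s. f s * G s)"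
proof (rule Bochner_Integration.integrable_bound)
  show "integrable lborel (\<lambda>s. C * f s)" using assms(1) by simp
  show "(\<lambda>s. f s * G s) \<in> borel_measurable lborel"
    using assms(1,2) borel_measurable_integrable[OF assms(1)] by measurable
  show "AE s in lborel. norm (f s * G s) \<le> norm (C * f s)"
  proof (rule AE_I2)
    fix s
    have "\<bar>f s\<bar> * \<bar>G s\<bar> \<le> \<bar>f s\<bar> * \<bar>C\<bar>"
      using assms(3)[of s] by (intro mult_left_mono) auto
    thus "norm (f s * G s) \<le> norm (C * f s)" by (simp add: abs_mult mult.commute)
  qed
qed

context
  fixes G :: "real \<Rightarrow> real" and C :: real
  assumes G_meas [measurable]: "G \<in> borel_measurable borel"
    and G_bound: "\<And>s. \<bar>G s\<bar> \<le> C"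
    and G_periodic: "\<And>s. G (s + 1) = G s"
    and G_mean: "(\<integral>s. indicator {0..<1} s * G s \<partial>lborel) = 0"
begin

lemma C_nonneg: "0 \<le> C"
  using G_bound[of 0] by linarith

lemma integrable_scaled:
  assumes "integrable lborel f"
  shows "integrable lborel (\<lambda>s. f s * G (T * s))"
  using integrable_mult_bounded[of f "\<lambda>s. G (T * s)" C] assms G_bound by simp

text \<open>Full periods contribute nothing because \<open>G\<close> has mean zero. What is left is
  an incomplete period of length below 1, where \<open>G\<close> is at most \<open>C\<close> in
  absolute value. The induction removes one period at a time, so the bound does not grow with
  \<open>y\<close>.\<close>

lemma integral_initial_segment_bounded:
  assumes "0 \<le> y"
  shows "\<bar>\<integral>s. indicator {0..y} s * G s \<partial>lborel\<bar> \<le> C"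
proof -
  have int: "integrable lborel (\<lambda>s. indicator A s * G s)"
    if "A \<in> sets borel" "emeasure lborel A < \<infinity>" for A
    using integrable_scaled[of "indicator A" 1] that by simp
  have "\<bar>\<integral>s. indicator {0..y} s * G s \<partial>lborel\<bar> \<le> C" if "0 \<le> y" "y \<le> real n" for n y
    using that
  proof (induction n arbitrary: y)
    case 0
    hence "y = 0" by simp
    have "AE s in lborel. indicator {0..y} s * G s = 0"
      using AE_lborel_singleton[of "0::real"] \<open>y = 0\<close> by auto
    thus ?case using C_nonneg by (simp add: integral_eq_zero_AE)
  next
    case (Suc n)
    show ?case
    proof (cases "y < 1")
      case True
      have "\<bar>\<integral>s. indicator {0..y} s * G s \<partial>lborel\<bar> \<le> (\<integral>s. \<bar>indicator {0..y} s * G s\<bar> \<partial>lborel)"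
        by (rule integral_abs_bound)
      also have "\<dots> \<le> (\<integral>s. C * indicator {0..y} s \<partial>lborel)"
        using Suc.prems G_bound
        by (intro integral_mono integrable_abs int integrable_mult_right integrable_real_indicator)
           (auto simp: indicator_def)
      also have "\<dots> = C * y" using Suc.prems by simp
      also have "\<dots> \<le> C" using True C_nonneg by (simp add: mult_left_le)
      finally show ?thesis .
    next
      case False
      have "(\<integral>s. indicator {0..y} s * G s \<partial>lborel)
          = (\<integral>s. indicator {0..<1} s * G s + indicator {1..y} s * G s \<partial>lborel)"
        using False by (intro Bochner_Integration.integral_cong) (auto simp: indicator_def)
      also have "\<dots> = (\<integral>s. indicator {1..y} s * G s \<partial>lborel)"
        using False by (subst Bochner_Integration.integral_add) (auto intro!: int simp: G_mean)
      also have "\<dots> = (\<integral>s. indicator {1..y} (1 + s) * G (1 + s) \<partial>lborel)"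
        using lborel_integral_real_affine[of 1 "\<lambda>s. indicator {1..y} s * G s" 1] by simp
      also have "\<dots> = (\<integral>s. indicator {0..y-1} s * G s \<partial>lborel)"
        using G_periodic
        by (intro Bochner_Integration.integral_cong) (auto simp: indicator_def add.commute)
      finally show ?thesis using Suc.IH[of "y - 1"] Suc.prems False by simp
    qed
  qed
  from this[of y "nat \<lceil>y\<rceil>"] assms show ?thesis by linarith
qed

text \<open>Substituting \<open>T * s\<close> turns the integral into \<open>1 / T\<close> times an
  integral of \<open>G\<close> over \<open>{0..T * c}\<close>, which is bounded by \<open>C\<close>.
  Hence the decay is of order \<open>1 / T\<close>.\<close>

lemma integral_scaled_vanishes_segment:
  assumes "0 \<le> c"
  shows "integral_scaled_vanishes G (indicator {0..c})"
proof -
  have bound: "\<bar>\<integral>s. indicator {0..c} s * G (T * s) \<partial>lborel\<bar> \<le> C / T" if "T > 0" for T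
  proof -
    have "(\<integral>s. indicator {0..T * c} s * G s \<partial>lborel)
        = T * (\<integral>s. indicator {0..T * c} (T * s) * G (T * s) \<partial>lborel)"
      using lborel_integral_real_affine[of T "\<lambda>s. indicator {0..T * c} s * G s" 0] that by simp
    also have "(\<lambda>s. indicator {0..T * c} (T * s)) = (indicator {0..c} :: real \<Rightarrow> real)"
      using that by (auto simp: indicator_def fun_eq_iff zero_le_mult_iff)
    hence "(\<integral>s. indicator {0..T * c} (T * s) * G (T * s) \<partial>lborel) =
        (\<integral>s. indicator {0..c} s * G (T * s) \<partial>lborel)" by metis
    finally have "T * \<bar>\<integral>s. indicator {0..c} s * G (T * s) \<partial>lborel\<bar> \<le> C"
      using integral_initial_segment_bounded[of "T * c"] that assms by (simp add: abs_mult)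
    thus ?thesis using that by (simp add: field_simps)
  qed
  have "((\<lambda>T. C / T) \<longlongrightarrow> 0) at_top"
    by (intro tendsto_divide_0[OF tendsto_const] filterlim_at_top_imp_at_infinity filterlim_ident)
  thus ?thesis unfolding integral_scaled_vanishes_def
    by (rule Lim_null_comparison[rotated])
      (auto intro!: eventually_mono[OF eventually_gt_at_top[of 0]] bound)
qed

lemma integral_scaled_vanishes_add:
  assumes "integrable lborel f" "integrable lborel g"
    and "integral_scaled_vanishes G f" "integral_scaled_vanishes G g"
  shows "integral_scaled_vanishes G (\<lambda>s. f s + g s)"
  using tendsto_add[OF assms(3,4)[unfolded integral_scaled_vanishes_def]] assms(1,2)
  by (simp add: integral_scaled_vanishes_def distrib_right integrable_scaled)

lemma integral_scaled_vanishes_cmult: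
  assumes "integral_scaled_vanishes G f"
  shows "integral_scaled_vanishes G (\<lambda>s. c * f s)"
  using tendsto_mult_left[OF assms[unfolded integral_scaled_vanishes_def], of c]
  by (simp add: integral_scaled_vanishes_def mult.assoc)

text \<open>Replacing \<open>f\<close> by \<open>h i\<close> changes the integral by at most
  \<open>C\<close> times their L1 distance, uniformly in \<open>T\<close>. So \<open>i\<close> can
  be fixed first, and only then is \<open>T\<close> sent to infinity.\<close>

lemma integral_scaled_vanishes_L1_limit:
  assumes int: "\<And>i. integrable lborel (h i)" "integrable lborel f"
    and van: "\<And>i. integral_scaled_vanishes G (h i)"
    and lim: "(\<lambda>i::nat. \<integral>s. \<bar>f s - h i s\<bar> \<partial>lborel) \<longlonglongrightarrow> 0"
  shows "integral_scaled_vanishes G f"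
  unfolding integral_scaled_vanishes_def
proof (rule tendstoI)
  fix e :: real assume "0 < e"
  have "(\<lambda>i. C * (\<integral>s. \<bar>f s - h i s\<bar> \<partial>lborel)) \<longlonglongrightarrow> 0"
    using tendsto_mult_left[OF lim, of C] by simp
  from order_tendstoD(2)[OF this, of "e / 2"] \<open>0 < e\<close>
  obtain i where i: "C * (\<integral>s. \<bar>f s - h i s\<bar> \<partial>lborel) < e / 2"
    by (auto simp: eventually_sequentially)
  have "\<bar>\<integral>s. f s * G (T * s) \<partial>lborel\<bar> \<le> e / 2 + \<bar>\<integral>s. h i s * G (T * s) \<partial>lborel\<bar>" for T
  proof -
    have "(\<integral>s. f s * G (T * s) \<partial>lborel) - (\<integral>s. h i s * G (T * s) \<partial>lborel)
        = (\<integral>s. (f s - h i s) * G (T * s) \<partial>lborel)"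
      using int by (simp add: left_diff_distrib integrable_scaled)
    also have "\<bar>\<dots>\<bar> \<le> (\<integral>s. \<bar>(f s - h i s) * G (T * s)\<bar> \<partial>lborel)"
      by (rule integral_abs_bound)
    also have "\<dots> \<le> (\<integral>s. C * \<bar>f s - h i s\<bar> \<partial>lborel)"
    proof (rule integral_mono)
      show "integrable lborel (\<lambda>s. \<bar>(f s - h i s) * G (T * s)\<bar>)"
        using int by (intro integrable_abs integrable_scaled) auto
      show "integrable lborel (\<lambda>s. C * \<bar>f s - h i s\<bar>)" using int by auto
      show "\<bar>(f s - h i s) * G (T * s)\<bar> \<le> C * \<bar>f s - h i s\<bar>" for s
        using mult_right_mono[OF G_bound[of "T * s"], of "\<bar>f s - h i s\<bar>"]
        by (simp add: abs_mult mult.commute)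
    qed
    also have "\<dots> < e / 2" using i by simp
    finally show ?thesis by linarith
  qed
  note close = this
  have "\<forall>\<^sub>F T in at_top. \<bar>\<integral>s. h i s * G (T * s) \<partial>lborel\<bar> < e / 2"
    using tendstoD[OF van[of i, unfolded integral_scaled_vanishes_def], of "e / 2"] \<open>0 < e\<close>
    by simp
  thus "\<forall>\<^sub>F T in at_top. dist (\<integral>s. f s * G (T * s) \<partial>lborel) 0 < e"
  proof eventually_elim
    case (elim T)
    with close[of T] show ?case by simp
  qed
qed

text \<open>Dynkin system argument. The half-lines \<open>{..a}\<close> form an intersection-stable
  generator of the Borel sets, and their traces on \<open>{0..1}\<close> are empty or initial
  segments. Cutting down to \<open>{0..1}\<close> keeps all indicators integrable, so that
  complements can be taken.\<close>

lemma integral_scaled_vanishes_indicator: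
  assumes "A \<in> sets borel"
  shows "integral_scaled_vanishes G (indicator (A \<inter> {0..1}))"
proof -
  let ?S = "range (\<lambda>a. {..a::real})"
  have S: "sigma_sets UNIV ?S = sets borel"
    by (subst borel_eq_atMost) simp
  have int: "integrable lborel (indicator (B \<inter> {0..1}) :: real \<Rightarrow> real)" if "B \<in> sets borel" for B
    using integrable_real_mult_indicator[of B lborel "indicator {0..1}"] that
    by (simp add: indicator_inter_arith[abs_def] mult.commute)
  have "Int_stable ?S" by (auto simp: Int_stable_def)
  moreover have "?S \<subseteq> Pow UNIV" by simp
  moreover have "A \<in> sigma_sets UNIV ?S" using assms S by simp
  ultimately show ?thesis
  proof (induction rule: sigma_sets_induct_disjoint)
    case (basic A)
    then obtain a where "A = {..a}" by auto
    hence "A \<inter> {0..1} = (if a < 0 then {} else {0..min a 1})" by auto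
    thus ?case using integral_scaled_vanishes_segment[of "min a 1"]
      by (auto simp: integral_scaled_vanishes_def)
  next
    case empty
    show ?case by (simp add: integral_scaled_vanishes_def)
  next
    case (compl A)
    have *: "indicator ((UNIV - A) \<inter> {0..1})
      = (\<lambda>s. indicator {0..1} s + (-1) * indicator (A \<inter> {0..1}) s :: real)"
      by (auto simp: indicator_def)
    show ?case unfolding *
      using compl int[of A] S
      by (intro integral_scaled_vanishes_add integral_scaled_vanishes_segment
          integral_scaled_vanishes_cmult integrable_mult_right int) auto
  next
    case (union A)
    have [measurable]: "A i \<in> sets borel" for i using union(2) S by auto
    \<comment> \<open>By disjointness the partial sum \<open>h n\<close> is the indicator of the
      union of the first \<open>n\<close> sets, cut down to \<open>{0..1}\<close>. Dominated
      convergence makes these indicators converge in L1.\<close>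
    define h where "h = (\<lambda>n s. \<Sum>i<n. indicator (A i \<inter> {0..1}) s :: real)"
    have h_int: "integrable lborel (h n)" for n
      unfolding h_def by (intro Bochner_Integration.integrable_sum int) simp
    have h_eq: "h n s = indicator ((\<Union>i<n. A i) \<inter> {0..1}) s" for n s
    proof -
      have "disjoint_family_on A {..<n}"
        using union(1) by (auto simp: disjoint_family_on_def)
      hence "(indicator (\<Union>i<n. A i) s :: real) = (\<Sum>i<n. indicator (A i) s)"
        by (intro indicator_UN_disjoint) simp_all
      thus ?thesis by (simp add: h_def indicator_inter_arith sum_distrib_right)
    qed
    show ?case
    proof (rule integral_scaled_vanishes_L1_limit)
      show "integrable lborel (h n)" for n by (rule h_int)
      show "integrable lborel (indicator (\<Union> (range A) \<inter> {0..1}) :: real \<Rightarrow> real)"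
        by (rule int) auto
      show "integral_scaled_vanishes G (h n)" for n
      proof (induction n)
        case 0
        show ?case by (simp add: h_def integral_scaled_vanishes_def)
      next
        case (Suc n)
        have "h (Suc n) = (\<lambda>s. h n s + indicator (A n \<inter> {0..1}) s)"
          by (simp add: h_def fun_eq_iff)
        thus ?case using Suc union(3) h_int int[of "A n"]
          by (auto intro: integral_scaled_vanishes_add)
      qed
      have "(\<lambda>n. \<integral>s. \<bar>indicator (\<Union> (range A) \<inter> {0..1}) s - h n s\<bar> \<partial>lborel)
          \<longlonglongrightarrow> integral\<^sup>L lborel (\<lambda>s::real. 0 :: real)"
      proof (rule integral_dominated_convergence[where w = "indicator {0..1}"])
        have "(\<lambda>n. h n s) \<longlonglongrightarrow> indicator (\<Union> (range A) \<inter> {0..1}) s" for s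
          using LIMSEQ_indicator_UN[of "\<lambda>i. A i \<inter> {0..1}" s, where 'a = real]
          by (simp add: h_eq Int_UN_distrib2)
        from tendsto_rabs[OF tendsto_diff[OF tendsto_const this]]
        have "(\<lambda>n. \<bar>indicator (\<Union> (range A) \<inter> {0..1}) s - h n s\<bar>) \<longlonglongrightarrow>
            \<bar>indicator (\<Union> (range A) \<inter> {0..1}) s - indicator (\<Union> (range A) \<inter> {0..1}) s\<bar>" for s .
        thus "AE s in lborel. (\<lambda>n. \<bar>indicator (\<Union> (range A) \<inter> {0..1}) s - h n s\<bar>) \<longlonglongrightarrow> 0"
          by simp
        show "AE s in lborel. norm \<bar>indicator (\<Union> (range A) \<inter> {0..1}) s - h n s\<bar>
            \<le> indicator {0..1} s" for n
          by (auto simp: h_eq indicator_def)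
      qed (auto simp: h_def)
      thus "(\<lambda>n. \<integral>s. \<bar>indicator (\<Union> (range A) \<inter> {0..1}) s - h n s\<bar> \<partial>lborel) \<longlonglongrightarrow> 0"
        by simp
    qed
  qed
qed

text \<open>Induction over integrable functions: multiples of indicators, sums, and dominated
  pointwise limits, which are L1 limits by dominated convergence.\<close>

lemma integral_scaled_vanishes_unit_interval:
  assumes "integrable lborel f"
  shows "integral_scaled_vanishes G (\<lambda>s. indicator {0..1} s * f s)"
  using assms
proof (induct f)
  case (base A c)
  have "(\<lambda>s. indicator {0..1} s * (indicator A s *\<^sub>R c)) = (\<lambda>s. c * indicator (A \<inter> {0..1}) s)"
    by (auto simp: indicator_def)
  thus ?case using base
    by (simp add: integral_scaled_vanishes_cmult integral_scaled_vanishes_indicator)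
next
  case (add f g)
  have int: "integrable lborel (\<lambda>s. indicator {0..1} s * f s)" if "integrable lborel f" for f :: "real \<Rightarrow> real"
    using integrable_mult_indicator[OF _ that, of "{0..1}"] by simp
  have "(\<lambda>s. indicator {0..1} s * (f s + g s)) =
      (\<lambda>s. indicator {0..1} s * f s + indicator {0..1} s * g s)"
    by (simp add: distrib_left)
  thus ?case using add by (simp add: integral_scaled_vanishes_add int)
next
  case (lim f h)
  have int: "integrable lborel (\<lambda>s. indicator {0..1} s * f s)" if "integrable lborel f" for f :: "real \<Rightarrow> real"
    using integrable_mult_indicator[OF _ that, of "{0..1}"] by simp
  have [measurable]: "f \<in> borel_measurable borel" "h i \<in> borel_measurable borel" for i
    using borel_measurable_integrable[OF lim(5)] borel_measurable_integrable[OF lim(1)[of i]] by auto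
  show ?case
  proof (rule integral_scaled_vanishes_L1_limit[where h = "\<lambda>i s. indicator {0..1} s * h i s"])
    show "integrable lborel (\<lambda>s. indicator {0..1} s * f s)" by (rule int[OF lim(5)])
    show "integrable lborel (\<lambda>s. indicator {0..1} s * h i s)" for i by (rule int[OF lim(1)])
    show "integral_scaled_vanishes G (\<lambda>s. indicator {0..1} s * h i s)" for i by (rule lim(2))
    \<comment> \<open>The induction principle supplies
      \<open>\<bar>h i s\<bar> \<le> 2 * \<bar>f s\<bar>\<close>, whence the dominating function
      \<open>3 * \<bar>f s\<bar>\<close> for the difference.\<close>
    have "(\<lambda>i. \<integral>s. \<bar>indicator {0..1} s * f s - indicator {0..1} s * h i s\<bar> \<partial>lborel)
        \<longlonglongrightarrow> integral\<^sup>L lborel (\<lambda>s::real. 0 :: real)"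
    proof (rule integral_dominated_convergence[where w = "\<lambda>s. 3 * \<bar>f s\<bar>"])
      show "integrable lborel (\<lambda>s. 3 * \<bar>f s\<bar>)" using lim(5) by auto
      have "(\<lambda>i. \<bar>indicator {0..1} s * f s - indicator {0..1} s * h i s\<bar>) \<longlonglongrightarrow>
          \<bar>indicator {0..1} s * f s - indicator {0..1} s * f s\<bar>" for s
        by (intro tendsto_intros lim(3)) simp
      thus "AE s in lborel. (\<lambda>i. \<bar>indicator {0..1} s * f s - indicator {0..1} s * h i s\<bar>) \<longlonglongrightarrow> 0"
        by simp
      show "AE s in lborel. norm \<bar>indicator {0..1} s * f s - indicator {0..1} s * h i s\<bar>
          \<le> 3 * \<bar>f s\<bar>" for i
      proof (rule AE_I2)
        fix s :: real
        show "norm \<bar>indicator {0..1} s * f s - indicator {0..1} s * h i s\<bar> \<le> 3 * \<bar>f s\<bar>"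
          using lim(4)[of s i] by (auto simp: indicator_def)
      qed
    qed auto
    thus "(\<lambda>i. \<integral>s. \<bar>indicator {0..1} s * f s - indicator {0..1} s * h i s\<bar> \<partial>lborel) \<longlonglongrightarrow> 0"
      by simp
  qed
qed

end

text \<open>Fejer's generalisation of the Riemann--Lebesgue lemma.\<close>

lemma integral_scaled_periodic_tendsto:
  fixes f h :: "real \<Rightarrow> real"
  assumes f: "integrable lborel f" "\<And>s. s \<notin> {0..1} \<Longrightarrow> f s = 0"
    and h [measurable]: "h \<in> borel_measurable borel"
    and bound: "\<And>s. \<bar>h s\<bar> \<le> C"
    and per: "\<And>s. h (s + 1) = h s"
  shows "((\<lambda>T. \<integral>s. f s * h (T * s) \<partial>lborel) \<longlongrightarrow>
    (\<integral>s. f s \<partial>lborel) * (\<integral>s. indicator {0..<1} s * h s \<partial>lborel)) at_top"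
proof -
  \<comment> \<open>Subtracting the mean \<open>m\<close> over one period reduces to mean zero, at
    the price of the larger bound \<open>C + \<bar>m\<bar>\<close>.\<close>
  define m where "m = (\<integral>s. indicator {0..<1} s * h s \<partial>lborel)"
  have "integrable lborel (\<lambda>s. indicator {0..<1} s * h s)"
    by (rule integrable_mult_bounded[OF _ h bound]) simp
  hence "(\<integral>s. indicator {0..<1} s * (h s - m) \<partial>lborel) = 0"
    by (simp add: right_diff_distrib m_def)
  moreover have "\<bar>h s - m\<bar> \<le> C + \<bar>m\<bar>" for s
    using bound[of s] by linarith
  ultimately have "integral_scaled_vanishes (\<lambda>s. h s - m) (\<lambda>s. indicator {0..1} s * f s)"
    using f(1) by (intro integral_scaled_vanishes_unit_interval[where C = "C + \<bar>m\<bar>"]) (auto simp: per)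
  moreover have "(\<lambda>s. indicator {0..1} s * f s) = f"
    using f(2) by (intro ext) (metis indicator_simps mult_1 mult_zero_left)
  moreover have "integrable lborel (\<lambda>s. f s * h (T * s))" for T
    using integrable_mult_bounded[of f "\<lambda>s. h (T * s)" C] f(1) bound by simp
  ultimately have "((\<lambda>T. (\<integral>s. f s * h (T * s) \<partial>lborel) - (\<integral>s. f s \<partial>lborel) * m) \<longlongrightarrow> 0) at_top"
    using f(1) by (simp add: integral_scaled_vanishes_def right_diff_distrib)
  thus ?thesis unfolding m_def by (rule LIM_zero_cancel)
qed

section \<open>Lattice points in a dilated square\<close>

text \<open>For \<open>s \<ge> 0\<close> the integer part counts the integers in
  \<open>{x - s..x + s}\<close>. Floor and ceiling are used instead of a cardinality because then
  periodicity and the bound by 1 persist for negative \<open>s\<close>, where the interval is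
  empty.\<close>

definition interval_discrepancy :: "real \<Rightarrow> real \<Rightarrow> real" where
  "interval_discrepancy x s = of_int (\<lfloor>x + s\<rfloor> - \<lceil>x - s\<rceil> + 1) - 2 * s"

lemma interval_discrepancy_measurable [measurable]: "interval_discrepancy x \<in> borel_measurable borel"
  unfolding interval_discrepancy_def by measurable

lemma interval_discrepancy_periodic: "interval_discrepancy x (s + 1) = interval_discrepancy x s"
proof -
  have "\<lfloor>x + (s + 1)\<rfloor> = \<lfloor>x + s\<rfloor> + 1" "\<lceil>x - (s + 1)\<rceil> = \<lceil>x - s\<rceil> - 1"
    by linarith+
  thus ?thesis by (simp add: interval_discrepancy_def)
qed

text \<open>The value is 1 minus the two rounding losses of floor and ceiling, each of which lies in
  \<open>{0..<1}\<close>.\<close>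

lemma abs_interval_discrepancy_le_1: "\<bar>interval_discrepancy x s\<bar> \<le> 1"
  unfolding interval_discrepancy_def by linarith

lemma card_Icc_Int_Ints:
  fixes l u :: real
  shows "card ({l..u} \<inter> \<int>) = nat (\<lfloor>u\<rfloor> - \<lceil>l\<rceil> + 1)"
proof -
  have "{l..u} \<inter> \<int> = of_int ` {\<lceil>l\<rceil>..\<lfloor>u\<rfloor>}"
    by (auto simp: Ints_def image_iff le_floor_iff ceiling_le_iff)
  thus ?thesis by (simp add: card_image inj_on_def)
qed

text \<open>The square is symmetric about 0, so a negative \<open>t\<close> acts like
  \<open>\<bar>t\<bar>\<close>. Covering every real \<open>t\<close> is what later gives
  measurability of the remainder on the whole line.\<close>

lemma dilate_translate_Rect:
  assumes "0 < a"
  shows "dilate_translate t (Rect a a) (x, x) = {x - \<bar>t\<bar> * a..x + \<bar>t\<bar> * a} \<times> {x - \<bar>t\<bar> * a..x + \<bar>t\<bar> * a}"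
proof -
  have img: "(\<lambda>p. t * p + x) ` {-a..a} = {x - \<bar>t\<bar> * a..x + \<bar>t\<bar> * a}"
    using assms image_affinity_atLeastAtMost[of t x "-a" a] by (auto simp: abs_if algebra_simps)
  have "(\<lambda>p. t *\<^sub>R p + (x, x)) = map_prod (\<lambda>p. t * p + x) (\<lambda>p. t * p + x)"
    by (auto simp: fun_eq_iff)
  thus ?thesis
    by (simp only: dilate_translate_def Rect_def map_prod_surj_on img)
qed

text \<open>With \<open>N\<close> integers in the interval of half-length
  \<open>s = \<bar>t\<bar> * a\<close>, the remainder is a difference of squares,
  \<open>N\<^sup>2 - (2 * s)\<^sup>2\<close>. The factor \<open>N - 2 * s\<close> is the
  discrepancy, and \<open>N + 2 * s\<close> is \<open>4 * s\<close> plus the discrepancy.\<close>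

lemma lattice_remainder_Rect:
  assumes "0 < a"
  shows "lattice_remainder t (Rect a a) (x, x) =
    interval_discrepancy x (\<bar>t\<bar> * a) * (4 * \<bar>t\<bar> * a + interval_discrepancy x (\<bar>t\<bar> * a))"
proof -
  define s where "s = \<bar>t\<bar> * a"
  have "0 \<le> s" using assms by (simp add: s_def)
  define N where "N = \<lfloor>x + s\<rfloor> - \<lceil>x - s\<rceil> + 1"
  \<comment> \<open>Nonnegativity of \<open>N\<close> removes the truncation by \<open>nat\<close>
    in the count.\<close>
  have "0 \<le> N" using \<open>0 \<le> s\<close> unfolding N_def by linarith
  have "dilate_translate t (Rect a a) (x, x) \<inter> \<int> \<times> \<int>
      = ({x - s..x + s} \<inter> \<int>) \<times> ({x - s..x + s} \<inter> \<int>)"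
    using assms by (auto simp: dilate_translate_Rect s_def)
  hence "real (card (dilate_translate t (Rect a a) (x, x) \<inter> \<int> \<times> \<int>)) = (of_int N)\<^sup>2"
    using \<open>0 \<le> N\<close> by (simp add: card_cartesian_product card_Icc_Int_Ints power2_eq_square flip: N_def)
  moreover have "measure lebesgue (Rect a a) = 4 * a\<^sup>2"
  proof -
    have "Rect a a = cbox (-a, -a) (a, a)" by (simp add: Rect_def cbox_Pair_eq)
    thus ?thesis using assms by (simp add: content_Pair power2_eq_square)
  qed
  moreover have "t\<^sup>2 * (4 * a\<^sup>2) = 4 * s\<^sup>2" by (simp add: s_def power_mult_distrib)
  ultimately have "lattice_remainder t (Rect a a) (x, x) = (of_int N)\<^sup>2 - 4 * s\<^sup>2"
    by (simp add: lattice_remainder_def)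
  also have "\<dots> = (of_int N - 2 * s) * (4 * s + (of_int N - 2 * s))"
    by (simp add: power2_eq_square algebra_simps)
  also have "of_int N - 2 * s = interval_discrepancy x s"
    by (simp add: interval_discrepancy_def N_def)
  finally show ?thesis by (simp add: s_def)
qed

section \<open>One period of the discrepancy and its moments\<close>

text \<open>As \<open>s\<close> grows from 0 to 1, the integer \<open>\<lfloor>x\<rfloor>\<close>
  enters the interval at \<open>s = frac x\<close> and the next integer at
  \<open>s = 1 - frac x\<close>; no other integer is reached. The smaller of these two times is
  \<open>m\<close>, the larger \<open>1 - m\<close>.\<close>

lemma interval_discrepancy_unit:
  assumes "0 \<le> s" "s < 1" and m: "m = min (frac x) (1 - frac x)"
  shows "interval_discrepancy x s = (if s < m then 0 else if s < 1 - m then 1 else 2) - 2 * s"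
proof -
  define n where "n = \<lfloor>x\<rfloor>"
  define f where "f = frac x"
  have x: "x = of_int n + f" by (simp add: n_def f_def frac_def)
  have f: "0 \<le> f" "f < 1" by (simp_all add: f_def frac_lt_1)
  have "\<lfloor>x + s\<rfloor> = n + (if f + s < 1 then 0 else 1)"
    using f assms(1,2) by (intro floor_unique) (auto simp: x)
  moreover have "\<lceil>x - s\<rceil> = n + (if s < f then 1 else 0)"
    using f assms(1,2) by (intro ceiling_unique) (auto simp: x)
  ultimately show ?thesis
    using f by (auto simp: interval_discrepancy_def m min_def simp flip: f_def)
qed

text \<open>Moving down from \<open>x\<close>, the first integer met is
  \<open>\<lfloor>x\<rfloor>\<close>.\<close>

lemma t2_0_eq_frac: "t2_0 x = frac x"
  unfolding t2_0_def
proof (rule Least_equality)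
  show "0 \<le> frac x \<and> - frac x + x \<in> \<int>" by (simp add: frac_def)
next
  fix t assume t: "0 \<le> t \<and> - t + x \<in> \<int>"
  then obtain k where "x = t + of_int k" by (metis Ints_cases add.commute diff_add_cancel uminus_add_conv_diff)
  hence "of_int k \<le> x" using t by simp
  hence "k \<le> \<lfloor>x\<rfloor>" by (simp add: le_floor_iff)
  hence "real_of_int k \<le> of_int \<lfloor>x\<rfloor>" by simp
  thus "frac x \<le> t" using \<open>x = t + of_int k\<close> by (simp add: frac_def)
qed

text \<open>Reflecting \<open>x\<close> to \<open>- x\<close> exchanges the two hitting
  conditions.\<close>

lemma t1_0_eq_frac: "t1_0 x = frac (- x)"
proof -
  have "t + x \<in> \<int> \<longleftrightarrow> - t + - x \<in> \<int>" for t
    by (metis minus_add_distrib minus_in_Ints_iff)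
  thus ?thesis using t2_0_eq_frac[of "- x"] by (simp add: t1_0_def t2_0_def)
qed

text \<open>For non-integer \<open>x\<close> the two times add up to 1, so they differ by
  \<open>1 - 2 * m\<close>. For integer \<open>x\<close> both are 0, and so is
  \<open>2 * m\<close>.\<close>

lemma abs_t2_0_diff_t1_0:
  assumes m: "m = min (frac x) (1 - frac x)"
  shows "\<bar>t2_0 x - t1_0 x\<bar> \<in> {2 * m, 1 - 2 * m}"
  using frac_lt_1[of x] frac_ge_0[of x]
  by (cases "x \<in> \<int>") (auto simp: t2_0_eq_frac t1_0_eq_frac frac_neg m min_def abs_if simp flip: frac_eq_0_iff)

lemma has_bochner_integral_affine_power:
  assumes "p \<le> q"
  shows "has_bochner_integral lborel (\<lambda>s. (c - 2 * s) ^ k * indicator {p..q} s)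
    (((c - 2 * p) ^ Suc k - (c - 2 * q) ^ Suc k) / (2 * real (Suc k)))"
proof -
  define F where "F = (\<lambda>s. - ((c - 2 * s) ^ Suc k / (2 * real (Suc k))))"
  have "DERIV F s :> (c - 2 * s) ^ k" for s
    unfolding F_def by (auto intro!: derivative_eq_intros simp del: power_Suc of_nat_Suc)
  hence "has_bochner_integral lborel (\<lambda>s. (c - 2 * s) ^ k * indicator {p..q} s) (F q - F p)"
    by (intro has_bochner_integral_FTC_Icc_real assms) auto
  thus ?thesis by (simp add: F_def diff_divide_distrib del: power_Suc of_nat_Suc)
qed

lemma integral_interval_discrepancy_power:
  assumes m: "m = min (frac x) (1 - frac x)"
  shows "(\<integral>s. indicator {0..<1} s * interval_discrepancy x s ^ k \<partial>lborel) =
    (1 + (-1) ^ k) * ((2 * m) ^ Suc k + (1 - 2 * m) ^ Suc k) / (2 * real (Suc k))"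
proof -
  let ?g = "\<lambda>s. (0 - 2 * s) ^ k * indicator {0..m} s + (1 - 2 * s) ^ k * indicator {m..1-m} s
      + (2 - 2 * s) ^ k * indicator {1-m..1} s"
  have m01: "0 \<le> m" "m \<le> 1 - m" "1 - m \<le> 1"
    using frac_lt_1[of x] frac_ge_0[of x] by (auto simp: m min_def)
  \<comment> \<open>The closed pieces in \<open>?g\<close> overlap at their end points, and
    \<open>?g\<close> may be nonzero at 1, so a finite set of points is excluded.\<close>
  have AE: "AE s in lborel. indicator {0..<1} s * interval_discrepancy x s ^ k = ?g s"
    using AE_lborel_singleton[of m] AE_lborel_singleton[of "1 - m"] AE_lborel_singleton[of 1]
      AE_lborel_singleton[of 0]
  proof eventually_elim
    case (elim s)
    show ?case
    proof (cases "0 \<le> s \<and> s < 1")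
      case True
      thus ?thesis using interval_discrepancy_unit[OF _ _ m, of s] m01 elim
        by (auto simp: indicator_def)
    next
      case False
      thus ?thesis using m01 elim by (auto simp: indicator_def)
    qed
  qed
  have "(\<integral>s. indicator {0..<1} s * interval_discrepancy x s ^ k \<partial>lborel) = (\<integral>s. ?g s \<partial>lborel)"
    using AE by (intro integral_cong_AE) auto
  also have "\<dots> = ((0 - 2 * 0) ^ Suc k - (0 - 2 * m) ^ Suc k) / (2 * real (Suc k))
      + ((1 - 2 * m) ^ Suc k - (1 - 2 * (1 - m)) ^ Suc k) / (2 * real (Suc k))
      + ((2 - 2 * (1 - m)) ^ Suc k - (2 - 2 * 1) ^ Suc k) / (2 * real (Suc k))"
    by (intro has_bochner_integral_integral_eq has_bochner_integral_add
        has_bochner_integral_affine_power m01)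
  \<comment> \<open>Up to the common denominator, the outer pieces give
    \<open>(-1) ^ k * (2 * m) ^ Suc k\<close> and \<open>(2 * m) ^ Suc k\<close>. On the middle
    piece the discrepancy runs from \<open>1 - 2 * m\<close> to its negative, which produces the
    same factor \<open>1 + (-1) ^ k\<close>.\<close>
  also have "\<dots> = (1 + (-1) ^ k) * ((2 * m) ^ Suc k + (1 - 2 * m) ^ Suc k) / (2 * real (Suc k))"
  proof -
    have 0: "0 - 2 * m = - (2 * m)" "1 - 2 * (1 - m) = - (1 - 2 * m)" by simp_all
    have 1: "(- q) ^ Suc k = - ((-1) ^ k * q ^ Suc k)" for q :: real
      using power_minus[of q "Suc k"] by simp
    have 2: "2 - 2 * (1 - m) = 2 * m" "(0 - 2 * 0) ^ Suc k = (0::real)" "(2 - 2 * 1) ^ Suc k = (0::real)"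
      by simp_all
    have 3: "(0 - - (e * p)) / d + (q - - (e * q)) / d + (p - 0) / d = (1 + e) * (p + q) / d"
      for e p q d :: real
      by (cases "d = 0") (simp_all add: field_simps)
    show ?thesis unfolding 0 1 2 by (rule 3)
  qed
  finally show ?thesis .
qed

text \<open>Whichever of its two possible values \<open>y\<close> takes, \<open>y\<close> and
  \<open>1 - y\<close> are \<open>2 * m\<close> and \<open>1 - 2 * m\<close> in some order, and the
  coefficient is symmetric in them.\<close>

lemma moment_coeff_eq:
  "moment_coeff x k = 4 ^ k * (\<integral>s. indicator {0..<1} s * interval_discrepancy x s ^ k \<partial>lborel)"
proof -
  define m where "m = min (frac x) (1 - frac x)"
  have "\<bar>t2_0 x - t1_0 x\<bar> = 2 * m \<or> \<bar>t2_0 x - t1_0 x\<bar> = 1 - 2 * m"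
    using abs_t2_0_diff_t1_0[OF m_def] by simp
  thus ?thesis
    by (elim disjE)
       (simp_all add: moment_coeff_def Let_def integral_interval_discrepancy_power[OF m_def] add.commute)
qed

section \<open>Weak convergence along a real parameter, and compact support\<close>

text \<open>The criterion by continuous step functions concerns sequences of distributions. A limit
  at infinity can be tested along sequences tending to infinity, which makes the criterion
  applicable.\<close>

lemma weak_conv_along_at_topI:
  fixes M :: "real \<Rightarrow> real measure"
  assumes M: "\<And>T. 0 < T \<Longrightarrow> real_distribution (M T)" and \<beta>: "real_distribution \<beta>"
    and conv: "\<And>u v. u < v \<Longrightarrow>
      ((\<lambda>T. \<integral>y. cts_step u v y \<partial>M T) \<longlongrightarrow> (\<integral>y. cts_step u v y \<partial>\<beta>)) at_top"
  shows "weak_conv_along M \<beta> at_top"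
  unfolding weak_conv_along_def
proof (intro allI impI tendsto_at_topI_sequentially)
  fix u :: real and X :: "nat \<Rightarrow> real"
  assume u: "isCont (cdf \<beta>) u" and X: "filterlim X at_top sequentially"
  \<comment> \<open>\<open>M T\<close> is known to be a distribution only for \<open>T > 0\<close>.
    The value 1 is an arbitrary positive replacement and affects only finitely many terms.\<close>
  define Y where "Y = (\<lambda>n. if 0 < X n then X n else 1)"
  have "\<forall>\<^sub>F n in sequentially. 0 < X n"
    using X by (simp add: filterlim_at_top_dense)
  hence eq: "\<forall>\<^sub>F n in sequentially. X n = Y n"
    by eventually_elim (simp add: Y_def)
  hence Y: "filterlim Y at_top sequentially"
    using X by (simp cong: filterlim_cong)
  have "weak_conv_m (\<lambda>n. M (Y n)) \<beta>"
    using filterlim_compose[OF conv Y]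
    by (intro integral_cts_step_conv_imp_weak_conv M \<beta>) (auto simp: Y_def)
  hence "(\<lambda>n. cdf (M (Y n)) u) \<longlonglongrightarrow> cdf \<beta> u"
    using u by (simp add: weak_conv_m_def weak_conv_def)
  moreover have "\<forall>\<^sub>F n in sequentially. cdf (M (Y n)) u = cdf (M (X n)) u"
    using eq by eventually_elim simp
  ultimately show "(\<lambda>n. cdf (M (X n)) u) \<longlonglongrightarrow> cdf \<beta> u"
    by (rule Lim_transform_eventually)
qed

text \<open>The complement of the support is the union of all open sets of measure 0. It is
  therefore open, and it contains \<open>- {l..u}\<close>, so the support is a closed subset of a
  compact interval.\<close>

lemma compact_measure_support:
  assumes "emeasure \<beta> (- {l..u}) = 0"
  shows "compact (measure_support \<beta>) \<and> measure_support \<beta> \<subseteq> {l..u}"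
proof -
  have "- measure_support \<beta> = \<Union>{U. open U \<and> emeasure \<beta> U = 0}"
    by (auto simp: measure_support_def not_gr_zero)
  hence "closed (measure_support \<beta>)"
    by (auto simp: closed_def intro: open_Union)
  moreover have "measure_support \<beta> \<subseteq> {l..u}"
  proof (rule subsetI, rule ccontr)
    fix y assume y: "y \<in> measure_support \<beta>" "y \<notin> {l..u}"
    have "open (- {l..u})" by (intro open_Compl) simp
    hence "0 < emeasure \<beta> (- {l..u})" using y unfolding measure_support_def by blast
    thus False using assms by simp
  qed
  ultimately show ?thesis
    using compact_Int_closed[of "{l..u}" "measure_support \<beta>"] by (simp add: Int_absorb1)
qed

section \<open>The law of the random dilation factor\<close>

context
  fixes \<rho> :: "real \<Rightarrow> real"
  assumes \<rho>_int: "set_integrable lborel {0..1} \<rho>"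
    and \<rho>_nonneg: "\<And>s. s \<in> {0..1} \<Longrightarrow> 0 \<le> \<rho> s"
    and \<rho>_total: "(LBINT s:{0..1}. \<rho> s) = 1"
begin

text \<open>Integrability on \<open>{0..1}\<close> gives measurability only of the product of
  \<open>\<rho>\<close> with the indicator, so the density is expressed through that
  product.\<close>

lemma scaled_law_eq:
  assumes "0 < T"
  shows "scaled_law \<rho> T = density lborel (\<lambda>t. ennreal (1 / T * (indicator {0..1} (t / T) * \<rho> (t / T))))"
proof -
  have "indicator {0..T} t = (indicator {0..1} (t / T) :: real)" for t
    using assms by (auto simp: indicator_def zero_le_divide_iff)
  thus ?thesis unfolding scaled_law_def by (simp add: mult.left_commute)
qed

lemma integrable_density_\<rho>: "integrable lborel (\<lambda>s. indicator {0..1} s * \<rho> s)"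
  using \<rho>_int by (simp add: set_integrable_def)

lemma density_\<rho>_measurable [measurable]:
  "(\<lambda>s. indicator {0..1} s * \<rho> s) \<in> borel_measurable borel"
  using borel_measurable_integrable[OF integrable_density_\<rho>] by simp

lemma scaled_density_measurable:
  "(\<lambda>t. 1 / T * (indicator {0..1} (t / T) * \<rho> (t / T))) \<in> borel_measurable borel"
proof -
  have "(\<lambda>t. t / T) \<in> borel \<rightarrow>\<^sub>M borel" by measurable
  from measurable_compose[OF this density_\<rho>_measurable] show ?thesis
    by (rule borel_measurable_times[OF borel_measurable_const])
qed

lemma scaled_density_nonneg:
  "0 < T \<Longrightarrow> 0 \<le> 1 / T * (indicator {0..1} (t / T) * \<rho> (t / T))"
  using \<rho>_nonneg[of "t / T"] by (auto simp: indicator_def)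

text \<open>The substitution \<open>t = T * s\<close> fixes the density and moves \<open>T\<close>
  into the argument of \<open>\<phi>\<close>, the form required by Fejer's lemma.\<close>

lemma integral_scaled_law:
  assumes T: "0 < T" and \<phi>: "\<phi> \<in> borel_measurable borel"
  shows "(\<integral>t. \<phi> t \<partial>scaled_law \<rho> T) = (\<integral>s. indicator {0..1} s * \<rho> s * \<phi> (T * s) \<partial>lborel)"
proof -
  have "(\<integral>t. \<phi> t \<partial>scaled_law \<rho> T)
      = (\<integral>t. 1 / T * (indicator {0..1} (t / T) * \<rho> (t / T)) *\<^sub>R \<phi> t \<partial>lborel)"
    using T \<phi> scaled_density_measurable[of T] scaled_density_nonneg[OF T]
    by (subst scaled_law_eq[OF T], subst integral_density) auto
  also have "\<dots> = (\<integral>s. indicator {0..1} s * \<rho> s * \<phi> (T * s) \<partial>lborel)"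
    using lborel_integral_real_affine[of T
        "\<lambda>t. 1 / T * (indicator {0..1} (t / T) * \<rho> (t / T)) *\<^sub>R \<phi> t" 0] T
    by (simp add: mult.assoc)
  finally show ?thesis .
qed

lemma prob_space_scaled_law:
  assumes T: "0 < T"
  shows "prob_space (scaled_law \<rho> T)"
proof (rule prob_spaceI)
  let ?g = "\<lambda>t. 1 / T * (indicator {0..1} (t / T) * \<rho> (t / T))"
  have "integrable lborel ?g"
    using lborel_integrable_real_affine[OF integrable_density_\<rho>, of "1 / T" 0] T by simp
  moreover have "(\<integral>t. ?g t \<partial>lborel) = 1"
    using lborel_integral_real_affine[of "1 / T" "\<lambda>s. indicator {0..1} s * \<rho> s" 0] T \<rho>_total
    by (simp add: set_lebesgue_integral_def)
  ultimately have "(\<integral>\<^sup>+t. ennreal (?g t) \<partial>lborel) = 1"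
    using scaled_density_nonneg[OF T] by (subst nn_integral_eq_integral) auto
  moreover have "(\<lambda>t. ennreal (?g t)) \<in> borel_measurable lborel"
    using scaled_density_measurable[of T] by simp
  ultimately show "emeasure (scaled_law \<rho> T) (space (scaled_law \<rho> T)) = 1"
    by (simp add: scaled_law_eq[OF T] emeasure_density)
qed

end

section \<open>The limit law, its range and its moments\<close>

definition discrepancy_law :: "real \<Rightarrow> real \<Rightarrow> real measure" where
  "discrepancy_law a x =
    distr (uniform_measure lborel {0..<1}) borel (\<lambda>s. 4 * a * interval_discrepancy x s)"

lemma uniform_measure_unit:
  "uniform_measure lborel {0..<1::real} = density lborel (\<lambda>s. ennreal (indicator {0..<1} s))"
  unfolding uniform_measure_def by (intro density_cong) (auto simp: indicator_def)

lemma real_distribution_discrepancy_law: "real_distribution (discrepancy_law a x)"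
proof -
  interpret prob_space "uniform_measure lborel {0..<1::real}"
    by (rule prob_space_uniform_measure) auto
  show ?thesis unfolding discrepancy_law_def by (rule real_distribution_distr) simp
qed

lemma integral_discrepancy_law:
  fixes \<phi> :: "real \<Rightarrow> real"
  assumes [measurable]: "\<phi> \<in> borel_measurable borel"
  shows "(\<integral>y. \<phi> y \<partial>discrepancy_law a x) =
    (\<integral>s. indicator {0..<1} s * \<phi> (4 * a * interval_discrepancy x s) \<partial>lborel)"
  unfolding discrepancy_law_def uniform_measure_unit
  by (subst integral_distr, simp, simp, subst integral_density) auto

text \<open>The discrepancy is at most 1 in absolute value, so the preimage is empty. This serves
  both the compactness of the support and the integrability of powers.\<close>

lemma emeasure_discrepancy_law_outside:
  assumes "0 < a"
  shows "emeasure (discrepancy_law a x) (- {- 4 * a..4 * a}) = 0"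
proof -
  have "4 * a * interval_discrepancy x s \<in> {- 4 * a..4 * a}" for s
    using assms abs_interval_discrepancy_le_1[of x s] mult_left_mono[of "interval_discrepancy x s" 1 "4 * a"]
      mult_left_mono[of "- 1" "interval_discrepancy x s" "4 * a"] by (auto simp: abs_le_iff)
  hence "(\<lambda>s. 4 * a * interval_discrepancy x s) -` (- {- 4 * a..4 * a}) = {}"
    by blast
  thus ?thesis unfolding discrepancy_law_def by (subst emeasure_distr) auto
qed

lemma integrable_discrepancy_law_power:
  assumes "0 < a"
  shows "integrable (discrepancy_law a x) (\<lambda>u. u ^ k)"
proof -
  interpret real_distribution "discrepancy_law a x"
    by (rule real_distribution_discrepancy_law)
  have "AE u in discrepancy_law a x. u \<in> {- 4 * a..4 * a}"
    using emeasure_discrepancy_law_outside[OF assms, of x]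
    by (intro AE_I[where N = "- {- 4 * a..4 * a}"]) auto
  hence "AE u in discrepancy_law a x. norm (u ^ k) \<le> (4 * a) ^ k"
  proof eventually_elim
    case (elim u)
    hence "\<bar>u\<bar> ^ k \<le> (4 * a) ^ k" by (intro power_mono) auto
    thus ?case by (simp only: real_norm_def power_abs)
  qed
  thus ?thesis by (rule integrable_const_bound) simp
qed

lemma moment_discrepancy_law:
  "(\<integral>u. u ^ k \<partial>discrepancy_law a x) = a ^ k * moment_coeff x k"
proof -
  have "(\<integral>u. u ^ k \<partial>discrepancy_law a x) =
      (\<integral>s. indicator {0..<1} s * (4 * a * interval_discrepancy x s) ^ k \<partial>lborel)"
    by (rule integral_discrepancy_law) simp
  also have "\<dots> = (\<integral>s. (4 * a) ^ k * (indicator {0..<1} s * interval_discrepancy x s ^ k) \<partial>lborel)"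
    by (simp only: power_mult_distrib mult_ac)
  also have "\<dots> = (4 * a) ^ k * (\<integral>s. indicator {0..<1} s * interval_discrepancy x s ^ k \<partial>lborel)"
    by (rule integral_mult_right_zero)
  finally show ?thesis by (simp add: moment_coeff_eq power_mult_distrib)
qed

section \<open>Convergence in distribution of the normalized remainder\<close>

theorem theorem4:
  fixes a x :: real and \<rho> :: "real \<Rightarrow> real"
  assumes "a > 0"
    and "set_integrable lborel {0..1} \<rho>"
    and "\<And>s. s \<in> {0..1} \<Longrightarrow> 0 \<le> \<rho> s"
    and "(LBINT s:{0..1}. \<rho> s) = 1"
  shows "\<exists>\<beta>. real_distribution \<beta>
    \<and> weak_conv_along (normalized_remainder_law a x \<rho>) \<beta> at_top
    \<and> compact (measure_support \<beta>)
    \<and> measure_support \<beta> \<subseteq> {- 4 * a .. 4 * a}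
    \<and> (\<forall>k. integrable \<beta> (\<lambda>u. u ^ k) \<and> (\<integral>u. u ^ k \<partial>\<beta>) = a ^ k * moment_coeff x k)"
proof -
  define R where "R = (\<lambda>t. lattice_remainder t (Rect a a) (x, x) / t)"
  \<comment> \<open>\<open>D\<close> is the main term of \<open>R\<close>: the discrepancy with the
    factor \<open>4 * a\<close> and the dilation by \<open>a\<close> included. For
    \<open>t > 0\<close> the error \<open>R t - D t\<close> is a squared discrepancy over
    \<open>t\<close>, hence at most \<open>1 / t\<close>.\<close>
  define D where "D = (\<lambda>s. 4 * a * interval_discrepancy x (a * s))"
  define g where "g = (\<lambda>s. indicator {0..1} s * \<rho> s)"
  have R_meas [measurable]: "R \<in> borel_measurable borel"
    unfolding R_def lattice_remainder_Rect[OF \<open>a > 0\<close>] by measurable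
  have D_meas [measurable]: "D \<in> borel_measurable borel"
    unfolding D_def by measurable
  have g_int: "integrable lborel g"
    unfolding g_def by (rule integrable_density_\<rho>[OF assms(2-4)])
  have g_meas [measurable]: "g \<in> borel_measurable borel"
    using borel_measurable_integrable[OF g_int] by simp
  have g_total: "(\<integral>s. g s \<partial>lborel) = 1"
    using assms(4) by (simp add: g_def set_lebesgue_integral_def)
  have R_eq: "R t - D t = (interval_discrepancy x (a * t))\<^sup>2 / t" if "0 < t" for t
    using that by (simp add: R_def D_def lattice_remainder_Rect[OF \<open>a > 0\<close>] field_simps power2_eq_square)
  have R_close: "((\<lambda>t. R t - D t) \<longlongrightarrow> 0) at_top"
  proof (rule Lim_null_comparison)
    show "\<forall>\<^sub>F t in at_top. norm (R t - D t) \<le> 1 / t"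
      using eventually_gt_at_top[of 0]
    proof eventually_elim
      case (elim t)
      have "(interval_discrepancy x (a * t))\<^sup>2 \<le> 1"
        using abs_interval_discrepancy_le_1 by (simp add: abs_square_le_1)
      thus ?case using elim by (simp add: R_eq divide_right_mono)
    qed
    show "((\<lambda>t. 1 / t) \<longlongrightarrow> (0::real)) at_top"
      by (intro tendsto_divide_0[OF tendsto_const] filterlim_at_top_imp_at_infinity filterlim_ident)
  qed
  have "weak_conv_along (normalized_remainder_law a x \<rho>) (discrepancy_law a x) at_top"
  proof (rule weak_conv_along_at_topI)
    fix T :: real assume "0 < T"
    then interpret prob_space "scaled_law \<rho> T"
      using prob_space_scaled_law[OF assms(2-4)] by blast
    have "R \<in> borel_measurable (scaled_law \<rho> T)"
      using R_meas by (simp add: scaled_law_def)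
    thus "real_distribution (normalized_remainder_law a x \<rho> T)"
      unfolding normalized_remainder_law_def R_def by (rule real_distribution_distr)
  next
    show "real_distribution (discrepancy_law a x)" by (rule real_distribution_discrepancy_law)
  next
    fix u v :: real assume "u < v"
    define \<phi> where "\<phi> = cts_step u v"
    have \<phi>_unif: "uniformly_continuous_on UNIV \<phi>"
      unfolding \<phi>_def by (rule cts_step_uniformly_continuous[OF \<open>u < v\<close>])
    have \<phi>_meas [measurable]: "\<phi> \<in> borel_measurable borel"
      unfolding \<phi>_def cts_step_def[abs_def] by measurable
    have \<phi>_bound: "0 \<le> \<phi> y" "\<phi> y \<le> 1" for y
      using \<open>u < v\<close> by (auto simp: \<phi>_def cts_step_def field_simps)
    have \<phi>_diff: "\<bar>\<phi> y - \<phi> z\<bar> \<le> 1" for y z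
      using \<phi>_bound[of y] \<phi>_bound[of z] by linarith
    define h where "h = (\<lambda>s. \<phi> (4 * a * interval_discrepancy x s))"
    have h_meas [measurable]: "h \<in> borel_measurable borel" unfolding h_def by measurable
    have h_bound: "\<bar>h s\<bar> \<le> 1" for s using \<phi>_bound by (simp add: h_def)

    \<comment> \<open>Neither \<open>R\<close> nor \<open>D\<close> has to converge, so continuity
      of \<open>\<phi>\<close> alone would not suffice; uniform continuity transfers their
      closeness.\<close>
    have close: "((\<lambda>t. \<phi> (R t) - \<phi> (D t)) \<longlongrightarrow> 0) at_top"
    proof (rule tendstoI)
      fix e :: real assume "0 < e"
      then obtain d where "0 < d" and d: "\<And>y z. dist y z < d \<Longrightarrow> dist (\<phi> y) (\<phi> z) < e"
        using \<phi>_unif unfolding uniformly_continuous_on_def by (metis UNIV_I)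
      have "\<forall>\<^sub>F t in at_top. dist (R t - D t) 0 < d" by (rule tendstoD[OF R_close \<open>0 < d\<close>])
      thus "\<forall>\<^sub>F t in at_top. dist (\<phi> (R t) - \<phi> (D t)) 0 < e"
        by eventually_elim (use d in \<open>auto simp: dist_real_def\<close>)
    qed
    \<comment> \<open>For \<open>s > 0\<close> the argument \<open>T * s\<close> tends to infinity,
      for \<open>s < 0\<close> the density \<open>g\<close> vanishes, and \<open>s = 0\<close> is a
      null set. The integrand is dominated by \<open>\<bar>g s\<bar>\<close>.\<close>
    have "((\<lambda>T. \<integral>s. g s * (\<phi> (R (T * s)) - \<phi> (D (T * s))) \<partial>lborel) \<longlongrightarrow>
        integral\<^sup>L lborel (\<lambda>s::real. 0 :: real)) at_top"
    proof (rule integral_dominated_convergence_at_top[where w = "\<lambda>s. \<bar>g s\<bar>"])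
      show "integrable lborel (\<lambda>s. \<bar>g s\<bar>)" using g_int by simp
      show "\<forall>\<^sub>F T in at_top. AE s in lborel. norm (g s * (\<phi> (R (T * s)) - \<phi> (D (T * s)))) \<le> \<bar>g s\<bar>"
        using \<phi>_diff by (auto simp: abs_mult mult_left_le)
      show "AE s in lborel. ((\<lambda>T. g s * (\<phi> (R (T * s)) - \<phi> (D (T * s)))) \<longlongrightarrow> 0) at_top"
        using AE_lborel_singleton[of 0]
      proof eventually_elim
        case (elim s)
        show ?case
        proof (cases "0 < s")
          case True
          have "filterlim (\<lambda>T. T * s) at_top at_top"
            using True by (intro filterlim_at_top_mult_tendsto_pos[OF tendsto_const] filterlim_ident)
          from tendsto_mult_right_zero[OF filterlim_compose[OF close this]] show ?thesis .
        next
          case False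
          thus ?thesis using elim by (simp add: g_def)
        qed
      qed
    qed measurable
    moreover have "((\<lambda>T. \<integral>s. g s * \<phi> (D (T * s)) \<partial>lborel) \<longlongrightarrow>
        (\<integral>y. \<phi> y \<partial>discrepancy_law a x)) at_top"
    proof -
      \<comment> \<open>\<open>h\<close> is invariant under shifts by 1, whereas \<open>D\<close> is
        invariant under shifts by \<open>1 / a\<close>. So the limit is taken for \<open>h\<close>
        first and then evaluated along \<open>a * T\<close>, which tends to infinity as
        \<open>a > 0\<close>.\<close>
      have "((\<lambda>T. \<integral>s. g s * h (T * s) \<partial>lborel) \<longlongrightarrow>
          (\<integral>s. g s \<partial>lborel) * (\<integral>s. indicator {0..<1} s * h s \<partial>lborel)) at_top"
        by (rule integral_scaled_periodic_tendsto[OF g_int _ h_meas h_bound])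
           (auto simp: g_def h_def interval_discrepancy_periodic)
      moreover have "(\<integral>s. indicator {0..<1} s * h s \<partial>lborel) = (\<integral>y. \<phi> y \<partial>discrepancy_law a x)"
        by (simp add: integral_discrepancy_law h_def)
      moreover have "filterlim (\<lambda>T. a * T) at_top at_top"
        using \<open>a > 0\<close> by (intro filterlim_tendsto_pos_mult_at_top[OF tendsto_const] filterlim_ident)
      ultimately have "((\<lambda>T. \<integral>s. g s * h (a * T * s) \<partial>lborel) \<longlongrightarrow>
          (\<integral>y. \<phi> y \<partial>discrepancy_law a x)) at_top"
        using filterlim_compose by (fastforce simp: g_total)
      thus ?thesis by (simp add: h_def D_def mult.assoc)
    qed
    ultimately have "((\<lambda>T. (\<integral>s. g s * (\<phi> (R (T * s)) - \<phi> (D (T * s))) \<partial>lborel)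
        + (\<integral>s. g s * \<phi> (D (T * s)) \<partial>lborel)) \<longlongrightarrow> (\<integral>y. \<phi> y \<partial>discrepancy_law a x)) at_top"
      using tendsto_add by fastforce
    \<comment> \<open>Once \<open>T > 0\<close>, the terms with \<open>D\<close> cancel, and the
      substitution \<open>t = T * s\<close> identifies the remaining integral with one against the
      law of the normalized remainder.\<close>
    moreover have "\<forall>\<^sub>F T in at_top. (\<integral>s. g s * (\<phi> (R (T * s)) - \<phi> (D (T * s))) \<partial>lborel)
        + (\<integral>s. g s * \<phi> (D (T * s)) \<partial>lborel) = (\<integral>y. \<phi> y \<partial>normalized_remainder_law a x \<rho> T)"
      using eventually_gt_at_top[of 0]
    proof eventually_elim
      case (elim T)
      have [measurable]: "R \<in> borel_measurable (scaled_law \<rho> T)"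
        using R_meas by (simp add: scaled_law_def)
      have "(\<integral>y. \<phi> y \<partial>normalized_remainder_law a x \<rho> T) = (\<integral>t. \<phi> (R t) \<partial>scaled_law \<rho> T)"
        unfolding normalized_remainder_law_def R_def[symmetric] by (intro integral_distr) simp_all
      also have "\<dots> = (\<integral>s. g s * \<phi> (R (T * s)) \<partial>lborel)"
        unfolding g_def by (intro integral_scaled_law[OF assms(2-4) elim]) simp_all
      moreover have "integrable lborel (\<lambda>s. g s * \<phi> (R (T * s)))"
          "integrable lborel (\<lambda>s. g s * \<phi> (D (T * s)))"
        using \<phi>_bound by (auto intro!: integrable_mult_bounded[OF g_int, where C = 1])
      ultimately show ?case by (simp add: right_diff_distrib)
    qed
    ultimately show "((\<lambda>T. \<integral>y. cts_step u v y \<partial>normalized_remainder_law a x \<rho> T) \<longlongrightarrow>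
        (\<integral>y. cts_step u v y \<partial>discrepancy_law a x)) at_top"
      unfolding \<phi>_def by (rule Lim_transform_eventually)
  qed
  moreover have "compact (measure_support (discrepancy_law a x)) \<and>
      measure_support (discrepancy_law a x) \<subseteq> {- 4 * a..4 * a}"
    using emeasure_discrepancy_law_outside[OF \<open>a > 0\<close>]
    by (intro compact_measure_support) simp
  ultimately show ?thesis
    using real_distribution_discrepancy_law integrable_discrepancy_law_power[OF \<open>a > 0\<close>]
      moment_discrepancy_law by blast
qed

end
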